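(* Let $(U,\Lambda,D,V)$ be an analytic problem with an MRD discretization of $V$ that is well-posed with respect to a norm $\|\cdot\|_{WP}$ on $U$ with constant $C$, i.e. $\|u\|_{WP}\le C\|Du\|_V$ for all $u\in U$. Then for every finite-dimensional trial space $U_M\subseteq U$ there is an admissible restriction $(R_N,V_N)$ with the following two properties. (i) (Uniform stability) $\|u_M\|_{WP}\le 2C\,\|R_ND(u_M)\|_{V_N}$ for all $u_M\in U_M$, where the constant $2C$ does not depend on $U_M$ or on $(R_N,V_N)$. (ii) (Convergence at the rate of the Trial Space Data Approximation) For every $C_A\ge 1$, every $u^*\in U$, every comparison trial object $u_M^*\in U_M$, and every $\tilde u_M\in U_M$ obtained by approximate residual minimization in the sense that $$\|R_ND(u^*-\tilde u_M)\|_{V_N}\le C_A\,\|R_ND(u^*-u_M^* )\|_{V_N},$$ one has $$\|u^*-\tilde u_M\|_{WP}\le C(2C_A+3)\,\|Du^*-Du_M^*\|_V .$$ In particular, for fixed $C_A$ and a sequence of trial spaces $U_M$ with such restrictions, if $\|Du^*-Du_M^*\|_V=\mathcal{O}(\varepsilon_M)$ for some null sequence $(\varepsilon_M)$, then $\|u^*-\tilde u_M\|_{WP}=\mathcal{O}(\varepsilon_M)$.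
   Context: Analytic problem: a real normed linear space $U$ (objects), a set $\Lambda$ of linear functionals on $U$, the data map $D:U\to\mathbb{R}^\Lambda$, $D(u)=\{\lambda(u)\}_{\lambda\in\Lambda}$, and a normed data space $V\subseteq\mathbb{R}^\Lambda$ containing $D(U)$ whose norm satisfies $\|Du\|_V=\sup_{\lambda\in\Lambda}|\lambda(u)|<\infty$ for all $u\in U$. MRD (monotone refinable dense) discretization of a normed data space $V$: a (nonempty) set of pairs $(R_N,V_N)$, called admissible restrictions, together with a relation $\preceq$ (refinement) on them, such that (1) each $V_N$ is a finite-dimensional real normed space with norm $\|\cdot\|_{V_N}$; (2) each $R_N:V\to V_N$ is linear; (3) (monotonicity) $(R_M,V_M)\preceq(R_N,V_N)$ implies $\|R_Mv\|_{V_M}\le\|R_Nv\|_{V_N}$ for all $v\in V$; (4) (refinement) for any two admissible restrictions $(R_M,V_M)$, $(R_N,V_N)$ there is an admissible restriction $(R_P,V_P)$ with $(R_M,V_M)\preceq(R_P,V_P)$ and $(R_N,V_N)\preceq(R_P,V_P)$; (5) (density) $\|v\|_V=\sup\|R_Nv\|_{V_N}$ for all $v\in V$, the supremum being over all admissible restrictions. The Trial Space Data Approximation is the approximation of $Du^*$ by elements $Du_M$, $u_M\in U_M$, in the norm $\|\cdot\|_V$. *)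

theory Defs
  imports
    "HOL-Analysis.Analysis"
    "HOL-Library.Function_Algebras"
    "HOL-Library.Landau_Symbols"
begin

instantiation "fun" :: (type, real_vector) real_vector
begin

definition scaleR_fun :: "real \<Rightarrow> ('a \<Rightarrow> 'b) \<Rightarrow> 'a \<Rightarrow> 'b" where
  "scaleR_fun c f = (\<lambda>x. c *\<^sub>R f x)"

instance
  by standard (auto simp: scaleR_fun_def fun_eq_iff scaleR_add_right scaleR_add_left)

end

definition finite_dim_subspace :: "'a::real_vector set \<Rightarrow> bool" where
  "finite_dim_subspace S \<longleftrightarrow> (\<exists>B. finite B \<and> S = span B)"

definition norm_on :: "'a::real_vector set \<Rightarrow> ('a \<Rightarrow> real) \<Rightarrow> bool" where
  "norm_on S n \<longleftrightarrow> subspace S \<and>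
     (\<forall>x\<in>S. 0 \<le> n x \<and> (n x = 0 \<longleftrightarrow> x = 0)) \<and>
     (\<forall>c. \<forall>x\<in>S. n (c *\<^sub>R x) = \<bar>c\<bar> * n x) \<and>
     (\<forall>x\<in>S. \<forall>y\<in>S. n (x + y) \<le> n x + n y)"

definition linear_from :: "'a::real_vector set \<Rightarrow> ('a \<Rightarrow> 'b::real_vector) \<Rightarrow> bool" where
  "linear_from S f \<longleftrightarrow>
     (\<forall>x\<in>S. \<forall>y\<in>S. f (x + y) = f x + f y) \<and> (\<forall>c. \<forall>x\<in>S. f (c *\<^sub>R x) = c *\<^sub>R f x)"

text \<open>The space of all real families indexed by \<open>\<Lambda>\<close> is encoded by the functions on all
  functionals that vanish outside \<open>\<Lambda>\<close>, with the pointwise operations.\<close>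

definition data_families :: "('u \<Rightarrow> real) set \<Rightarrow> (('u \<Rightarrow> real) \<Rightarrow> real) set" where
  "data_families \<Lambda> = {v. \<forall>l. l \<notin> \<Lambda> \<longrightarrow> v l = 0}"

definition data_map :: "('u \<Rightarrow> real) set \<Rightarrow> 'u \<Rightarrow> ('u \<Rightarrow> real) \<Rightarrow> real" where
  "data_map \<Lambda> u = (\<lambda>l. if l \<in> \<Lambda> then l u else 0)"

text \<open>Suprema of nonnegative reals are taken in the extended nonnegative reals, so that the
  equations below say both that the supremum is finite and what its value is. The supremum over
  an empty \<open>\<Lambda>\<close> is then 0.\<close>

definition analytic_problem ::
  "('u::real_normed_vector \<Rightarrow> real) set \<Rightarrow> (('u \<Rightarrow> real) \<Rightarrow> real) set \<Rightarrow>
    ((('u \<Rightarrow> real) \<Rightarrow> real) \<Rightarrow> real) \<Rightarrow> bool" where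
  "analytic_problem \<Lambda> V normV \<longleftrightarrow>
     (\<forall>l\<in>\<Lambda>. linear l) \<and>
     V \<subseteq> data_families \<Lambda> \<and> norm_on V normV \<and> range (data_map \<Lambda>) \<subseteq> V \<and>
     (\<forall>u. ennreal (normV (data_map \<Lambda> u)) = (SUP l\<in>\<Lambda>. ennreal \<bar>l u\<bar>))"

text \<open>A restriction is a pair of a map \<open>R\<close> and a normed space, the latter consisting of a
  subspace of the vector space \<open>'w\<close> and a norm on it. The spaces of a discretization thus live in
  one common vector space; since \<open>'w\<close> is arbitrary this loses no generality, as any set of vector
  spaces embeds into their direct sum.\<close>

type_synonym ('v, 'w) restriction = "('v \<Rightarrow> 'w) \<times> ('w set \<times> ('w \<Rightarrow> real))"

definition restr_map :: "('v, 'w) restriction \<Rightarrow> 'v \<Rightarrow> 'w" where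
  "restr_map r = fst r"

definition restr_space :: "('v, 'w) restriction \<Rightarrow> 'w set" where
  "restr_space r = fst (snd r)"

definition restr_norm :: "('v, 'w) restriction \<Rightarrow> 'w \<Rightarrow> real" where
  "restr_norm r = snd (snd r)"

definition mrd_discretization ::
  "'v::real_vector set \<Rightarrow> ('v \<Rightarrow> real) \<Rightarrow> ('v, 'w::real_vector) restriction set \<Rightarrow>
    (('v, 'w) restriction \<Rightarrow> ('v, 'w) restriction \<Rightarrow> bool) \<Rightarrow> bool" where
  "mrd_discretization V normV A leq \<longleftrightarrow>
     A \<noteq> {} \<and>
     (\<forall>r\<in>A. finite_dim_subspace (restr_space r) \<and> norm_on (restr_space r) (restr_norm r)) \<and>
     (\<forall>r\<in>A. restr_map r ` V \<subseteq> restr_space r \<and> linear_from V (restr_map r)) \<and>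
     (\<forall>r\<in>A. \<forall>s\<in>A. leq r s \<longrightarrow>
        (\<forall>v\<in>V. restr_norm r (restr_map r v) \<le> restr_norm s (restr_map s v))) \<and>
     (\<forall>r\<in>A. \<forall>s\<in>A. \<exists>t\<in>A. leq r t \<and> leq s t) \<and>
     (\<forall>v\<in>V. ennreal (normV v) = (SUP r\<in>A. ennreal (restr_norm r (restr_map r v))))"

definition well_posed ::
  "('u::real_normed_vector \<Rightarrow> real) set \<Rightarrow> ((('u \<Rightarrow> real) \<Rightarrow> real) \<Rightarrow> real) \<Rightarrow>
    ('u \<Rightarrow> real) \<Rightarrow> real \<Rightarrow> bool" where
  "well_posed \<Lambda> normV normWP C \<longleftrightarrow>
     norm_on UNIV normWP \<and> (\<forall>u. normWP u \<le> C * normV (data_map \<Lambda> u))"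

definition uniformly_stable ::
  "('u::real_normed_vector \<Rightarrow> real) set \<Rightarrow> ('u \<Rightarrow> real) \<Rightarrow> real \<Rightarrow> 'u set \<Rightarrow>
    (('u \<Rightarrow> real) \<Rightarrow> real, 'w::real_vector) restriction \<Rightarrow> bool" where
  "uniformly_stable \<Lambda> normWP C T r \<longleftrightarrow>
     (\<forall>u\<in>T. normWP u \<le> 2 * C * restr_norm r (restr_map r (data_map \<Lambda> u)))"

definition approx_residual_minimizer ::
  "('u::real_normed_vector \<Rightarrow> real) set \<Rightarrow>
    (('u \<Rightarrow> real) \<Rightarrow> real, 'w::real_vector) restriction \<Rightarrow> real \<Rightarrow> 'u \<Rightarrow> 'u \<Rightarrow> 'u \<Rightarrow> bool" where
  "approx_residual_minimizer \<Lambda> r C\<^sub>A us um ut \<longleftrightarrow>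
     restr_norm r (restr_map r (data_map \<Lambda> (us - ut)))
       \<le> C\<^sub>A * restr_norm r (restr_map r (data_map \<Lambda> (us - um)))"

definition convergence_bound ::
  "('u::real_normed_vector \<Rightarrow> real) set \<Rightarrow> ((('u \<Rightarrow> real) \<Rightarrow> real) \<Rightarrow> real) \<Rightarrow>
    ('u \<Rightarrow> real) \<Rightarrow> real \<Rightarrow> 'u set \<Rightarrow>
    (('u \<Rightarrow> real) \<Rightarrow> real, 'w::real_vector) restriction \<Rightarrow> bool" where
  "convergence_bound \<Lambda> normV normWP C T r \<longleftrightarrow>
     (\<forall>C\<^sub>A\<ge>1. \<forall>us. \<forall>um\<in>T. \<forall>ut\<in>T. approx_residual_minimizer \<Lambda> r C\<^sub>A us um ut \<longrightarrow>
        normWP (us - ut) \<le> C * (2 * C\<^sub>A + 3) * normV (data_map \<Lambda> us - data_map \<Lambda> um))"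

end

theory Submission
  imports Defs
begin

text \<open>
  Write \<open>p u\<close> for the full data norm \<open>\<parallel>D u\<parallel>\<close> and \<open>q r u\<close> for its restricted version \<open>\<parallel>R (D u)\<parallel>\<close>. All of
  them are seminorms on \<open>U\<close>, the \<open>q r\<close> are directed by refinement, and \<open>p\<close> is their pointwise
  supremum. Everything rests on one claim: on a finite-dimensional trial space a single restriction
  achieves \<open>p \<le> 2 q r\<close> (\<open>directed_seminorms_norming\<close>).

  To see this, cover the \<open>p\<close>-unit ball of the trial space by finitely many \<open>p\<close>-balls of a small
  radius (\<open>finite_net_span\<close>). By directedness one restriction nearly attains \<open>p\<close> at all the
  centres at once (\<open>directed_attains_on_finite\<close>), and since \<open>q r \<le> p\<close> the estimate passes from the
  centres to every point of the ball at the cost of a small multiple of the radius. Homogeneity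
  then extends it to the whole trial space.

  Stability follows by inserting the claim into the well-posedness inequality. For the error bound,
  split \<open>u* - u~\<close> at the comparison object \<open>u'\<close>. Well-posedness handles \<open>u* - u'\<close> and contributes
  \<open>C\<close>; stability handles \<open>u' - u~\<close>, whose restricted residual is at most \<open>1 + C\<^sub>A\<close> times that of
  \<open>u* - u'\<close> and so contributes \<open>2 C (1 + C\<^sub>A)\<close>. The sum is \<open>C (2 C\<^sub>A + 3)\<close>.
\<close>

section \<open>Seminorms and finite nets in finite-dimensional spaces\<close>

definition seminorm :: "('a::real_vector \<Rightarrow> real) \<Rightarrow> bool" where
  "seminorm p \<longleftrightarrow> (\<forall>c x. p (c *\<^sub>R x) = \<bar>c\<bar> * p x) \<and> (\<forall>x y. p (x + y) \<le> p x + p y)"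

lemma seminormD:
  assumes "seminorm p"
  shows "p (c *\<^sub>R x) = \<bar>c\<bar> * p x" "p (x + y) \<le> p x + p y"
  using assms by (auto simp: seminorm_def)

lemma seminorm_zero: "seminorm p \<Longrightarrow> p 0 = 0"
  using seminormD(1)[of p 0 0] by simp

lemma seminorm_minus: "seminorm p \<Longrightarrow> p (- x) = p x"
  using seminormD(1)[of p "-1" x] by simp

lemma seminorm_diff: "seminorm p \<Longrightarrow> p (x - y) \<le> p x + p y"
  using seminormD(2)[of p x "- y"] seminorm_minus[of p y] by simp

lemma seminorm_diff_commute: "seminorm p \<Longrightarrow> p (x - y) = p (y - x)"
  using seminorm_minus[of p "x - y"] by simp

lemma seminorm_le_add_diff: "seminorm p \<Longrightarrow> p x \<le> p y + p (x - y)"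
  using seminormD(2)[of p y "x - y"] by simp

lemma seminorm_nonneg: "seminorm p \<Longrightarrow> 0 \<le> p x"
  using seminorm_diff[of p x x] seminorm_zero[of p] by simp

text \<open>
  Allowing seminorms, rather than only norms, makes the induction on the spanning set work without
  completeness or closedness of subspaces. If the new vector \<open>b\<close> has \<open>p\<close>-distance zero from the old
  span, then every vector of the new span is arbitrarily close to the old span, and a net for a
  slightly larger ball there suffices. If the distance is \<open>d > 0\<close>, the coefficient of \<open>b\<close> is bounded
  by \<open>R / d\<close>, and a net arises from a grid for that coefficient and a net of the old span.
\<close>

lemma finite_net_span:
  fixes p :: "'a::real_vector \<Rightarrow> real"
  assumes p: "seminorm p" and "finite B" and "0 < e"
  shows "\<exists>F. finite F \<and> F \<subseteq> span B \<and> (\<forall>u\<in>span B. p u \<le> R \<longrightarrow> (\<exists>f\<in>F. p (u - f) < e))"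
  using \<open>finite B\<close> \<open>0 < e\<close>
proof (induction B arbitrary: R e rule: finite_induct)
  case empty
  then show ?case
    by (intro exI[of _ "{0}"]) (auto simp: seminorm_zero[OF p])
next
  case (insert b B)
  show ?case
  proof (cases "\<forall>\<delta>>0. \<exists>s\<in>span B. p (b - s) < \<delta>")
    case True
    have "e / 2 > 0" using insert.prems by simp
    from insert.IH[OF this, of "R + e / 2"]
    obtain F where F: "finite F" "F \<subseteq> span B"
      "\<And>u. u \<in> span B \<Longrightarrow> p u \<le> R + e / 2 \<Longrightarrow> \<exists>f\<in>F. p (u - f) < e / 2"
      by auto
    have "\<exists>f\<in>F. p (u - f) < e" if u: "u \<in> span (insert b B)" and pu: "p u \<le> R" for u
    proof -
      from u obtain t where t: "u - t *\<^sub>R b \<in> span B"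
        using span_breakdown_eq by blast
      \<comment> \<open>The approximant of \<open>b\<close> may depend on \<open>u\<close>, so the unbounded coefficient \<open>t\<close> does no harm.\<close>
      have "e / (2 * (\<bar>t\<bar> + 1)) > 0" using insert.prems by simp
      with True obtain s where s: "s \<in> span B" "p (b - s) < e / (2 * (\<bar>t\<bar> + 1))"
        by blast
      define v where "v = u - t *\<^sub>R b + t *\<^sub>R s"
      have v: "v \<in> span B"
        unfolding v_def using t s(1) by (intro span_add span_scale)
      have "u - v = t *\<^sub>R (b - s)"
        by (simp add: v_def algebra_simps)
      then have "p (u - v) = \<bar>t\<bar> * p (b - s)"
        by (simp add: seminormD(1)[OF p])
      also have "\<dots> \<le> (\<bar>t\<bar> + 1) * p (b - s)"
        by (intro mult_right_mono seminorm_nonneg[OF p]) simp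
      also have "\<dots> < e / 2"
        using s(2) by (simp add: field_simps)
      finally have uv: "p (u - v) < e / 2" .
      have "p v \<le> R + e / 2"
        using seminorm_le_add_diff[OF p, of v u] seminorm_diff_commute[OF p, of u v] uv pu by linarith
      with F(3)[OF v] obtain f where f: "f \<in> F" "p (v - f) < e / 2"
        by blast
      have "p (u - f) \<le> p (u - v) + p (v - f)"
        using seminormD(2)[OF p, of "u - v" "v - f"] by simp
      then show ?thesis using uv f by force
    qed
    moreover have "F \<subseteq> span (insert b B)"
      using F(2) span_mono[of B "insert b B"] by blast
    ultimately show ?thesis using F(1) by blast
  next
    case False
    then obtain d where d: "d > 0" "\<And>s. s \<in> span B \<Longrightarrow> d \<le> p (b - s)"
      by (auto simp: not_less)
    define k where "k = e / (2 * (p b + 1))"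
    have k: "k > 0"
      using insert.prems seminorm_nonneg[OF p, of b] by (simp add: k_def)
    obtain G where G: "finite G" "{- (R / d)..R / d} \<subseteq> (\<Union>g\<in>G. ball g k)"
      using seq_compact_imp_totally_bounded[of "{- (R / d)..R / d}"] k
      by (metis compact_Icc compact_imp_seq_compact)
    have "e / 2 > 0" using insert.prems by simp
    from insert.IH[OF this, of "R + R / d * p b"]
    obtain F where F: "finite F" "F \<subseteq> span B"
      "\<And>u. u \<in> span B \<Longrightarrow> p u \<le> R + R / d * p b \<Longrightarrow> \<exists>f\<in>F. p (u - f) < e / 2"
      by auto
    let ?H = "(\<lambda>(g, f). g *\<^sub>R b + f) ` (G \<times> F)"
    have "\<exists>h\<in>?H. p (u - h) < e" if u: "u \<in> span (insert b B)" and pu: "p u \<le> R" for u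
    proof -
      from u obtain t where t: "u - t *\<^sub>R b \<in> span B"
        using span_breakdown_eq by blast
      have "\<bar>t\<bar> * d \<le> p u"
      proof (cases "t = 0")
        case True
        then show ?thesis using seminorm_nonneg[OF p] by simp
      next
        case nz: False
        have "(- 1 / t) *\<^sub>R (u - t *\<^sub>R b) \<in> span B"
          by (rule span_scale[OF t])
        from d(2)[OF this] have "d \<le> p (b - (- 1 / t) *\<^sub>R (u - t *\<^sub>R b))" .
        also have "b - (- 1 / t) *\<^sub>R (u - t *\<^sub>R b) = (1 / t) *\<^sub>R u"
          using nz by (simp add: algebra_simps)
        finally have "d \<le> p u / \<bar>t\<bar>"
          by (simp add: seminormD(1)[OF p])
        then show ?thesis using nz by (simp add: field_simps)
      qed
      then have tR: "\<bar>t\<bar> \<le> R / d"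
        using pu d(1) by (simp add: field_simps)
      then have "t \<in> {- (R / d)..R / d}" by auto
      then obtain g where g: "g \<in> G" "\<bar>t - g\<bar> < k"
        using G(2) by (auto simp: dist_real_def abs_minus_commute)
      have "\<bar>t\<bar> * p b \<le> R / d * p b"
        using tR by (intro mult_right_mono seminorm_nonneg[OF p])
      then have "p (u - t *\<^sub>R b) \<le> R + R / d * p b"
        using seminorm_diff[OF p, of u "t *\<^sub>R b"] pu seminormD(1)[OF p, of t b] by linarith
      with F(3)[OF t] obtain f where f: "f \<in> F" "p (u - t *\<^sub>R b - f) < e / 2"
        by blast
      have "\<bar>t - g\<bar> * p b \<le> k * (p b + 1)"
        using g(2) k seminorm_nonneg[OF p, of b] by (intro mult_mono) auto
      also have "\<dots> = e / 2"
        using seminorm_nonneg[OF p, of b] by (simp add: k_def field_simps)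
      finally have "p ((t - g) *\<^sub>R b) \<le> e / 2"
        by (simp add: seminormD(1)[OF p])
      then have "p ((u - t *\<^sub>R b - f) + (t - g) *\<^sub>R b) < e"
        using f(2) seminormD(2)[OF p, of "u - t *\<^sub>R b - f" "(t - g) *\<^sub>R b"] by linarith
      also have "(u - t *\<^sub>R b - f) + (t - g) *\<^sub>R b = u - (g *\<^sub>R b + f)"
        by (simp add: algebra_simps)
      finally have "p (u - (g *\<^sub>R b + f)) < e" .
      then show ?thesis using g(1) f(1) by force
    qed
    moreover have "?H \<subseteq> span (insert b B)"
    proof -
      have "g *\<^sub>R b + f \<in> span (insert b B)" if "f \<in> F" for g f
      proof (rule span_add)
        show "g *\<^sub>R b \<in> span (insert b B)"
          by (intro span_scale span_base) simp
        show "f \<in> span (insert b B)"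
          using that F(2) span_mono[of B "insert b B"] by blast
      qed
      then show ?thesis by auto
    qed
    moreover have "finite ?H"
      using G(1) F(1) by simp
    ultimately show ?thesis by blast
  qed
qed

section \<open>Directed families of seminorms\<close>

lemma directed_attains_on_finite:
  fixes q :: "'i \<Rightarrow> 'a \<Rightarrow> real"
  assumes "finite F" and ne: "A \<noteq> {}"
    and directed: "\<And>r s. r \<in> A \<Longrightarrow> s \<in> A \<Longrightarrow> \<exists>t\<in>A. \<forall>u. q r u \<le> q t u \<and> q s u \<le> q t u"
    and near: "\<And>u. u \<in> F \<Longrightarrow> \<exists>r\<in>A. p u - e < q r u"
  shows "\<exists>r\<in>A. \<forall>u\<in>F. p u - e < q r u"
  using \<open>finite F\<close> near
proof (induction F rule: finite_induct)
  case empty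
  then show ?case using ne by auto
next
  case (insert x F)
  then obtain r s where rs: "r \<in> A" "\<forall>u\<in>F. p u - e < q r u" "s \<in> A" "p x - e < q s x"
    by (metis insert_iff)
  from directed[OF rs(1,3)] obtain t where "t \<in> A" "\<forall>u. q r u \<le> q t u \<and> q s u \<le> q t u"
    by blast
  then show ?case
    using rs by (metis insert_iff less_le_trans)
qed

text \<open>
  With a net of radius \<open>1/6\<close> for the unit ball and an error of \<open>1/6\<close> at its points, a unit vector
  \<open>u\<close> near the net point \<open>f\<close> has \<open>q r u \<ge> q r f - 1/6 \<ge> p f - 2/6 \<ge> p u - 3/6 = 1/2\<close>. This is where
  the factor \<open>2\<close> comes from; any factor above \<open>1\<close> could be reached in the same way.
\<close>

lemma directed_seminorms_norming:
  fixes p :: "'a::real_vector \<Rightarrow> real" and q :: "'i \<Rightarrow> 'a \<Rightarrow> real"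
  assumes p: "seminorm p" and q: "\<And>r. r \<in> A \<Longrightarrow> seminorm (q r)"
    and le: "\<And>r u. r \<in> A \<Longrightarrow> q r u \<le> p u"
    and ne: "A \<noteq> {}"
    and directed: "\<And>r s. r \<in> A \<Longrightarrow> s \<in> A \<Longrightarrow> \<exists>t\<in>A. \<forall>u. q r u \<le> q t u \<and> q s u \<le> q t u"
    and near: "\<And>u e. 0 < e \<Longrightarrow> \<exists>r\<in>A. p u - e < q r u"
    and T: "finite_dim_subspace T"
  shows "\<exists>r\<in>A. \<forall>u\<in>T. p u \<le> 2 * q r u"
proof -
  obtain B where B: "finite B" "T = span B"
    using T by (auto simp: finite_dim_subspace_def)
  obtain F where F: "finite F" "\<And>u. u \<in> T \<Longrightarrow> p u \<le> 1 \<Longrightarrow> \<exists>f\<in>F. p (u - f) < 1 / 6"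
    using finite_net_span[OF p B(1), of "1 / 6" 1] B(2) by auto
  obtain r where r: "r \<in> A" "\<And>f. f \<in> F \<Longrightarrow> p f - 1 / 6 < q r f"
    using directed_attains_on_finite[OF F(1) ne directed, of p "1 / 6"] near by auto
  have unit: "1 / 2 \<le> q r u" if u: "u \<in> T" and pu: "p u = 1" for u
  proof -
    obtain f where f: "f \<in> F" "p (u - f) < 1 / 6"
      using F(2)[OF u] pu by (metis order_refl)
    have "q r f \<le> q r u + q r (u - f)"
      using seminorm_le_add_diff[OF q[OF r(1)], of f u]
        seminorm_diff_commute[OF q[OF r(1)], of f u] by simp
    then show ?thesis
      using r(2)[OF f(1)] le[OF r(1), of "u - f"] f(2)
        seminorm_le_add_diff[OF p, of u f] pu by linarith
  qed
  have "p u \<le> 2 * q r u" if u: "u \<in> T" for u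
  proof (cases "p u = 0")
    case True
    then show ?thesis using seminorm_nonneg[OF q[OF r(1)], of u] by simp
  next
    case False
    then have pos: "p u > 0" using seminorm_nonneg[OF p, of u] by simp
    have "(1 / p u) *\<^sub>R u \<in> T"
      using u B(2) span_scale by blast
    moreover have "p ((1 / p u) *\<^sub>R u) = 1"
      using pos by (simp add: seminormD(1)[OF p])
    ultimately have "1 / 2 \<le> q r ((1 / p u) *\<^sub>R u)"
      by (rule unit)
    also have "\<dots> = q r u / p u"
      using pos by (simp add: seminormD(1)[OF q[OF r(1)]])
    finally show ?thesis using pos by (simp add: field_simps)
  qed
  with r(1) show ?thesis by blast
qed

section \<open>Restricted data norms\<close>

lemma norm_on_linear_seminorm:
  fixes f :: "'u::real_vector \<Rightarrow> 'a::real_vector"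
  assumes "norm_on S n" "range f \<subseteq> S" "linear f"
  shows "seminorm (\<lambda>u. n (f u))"
proof -
  have "f u \<in> S" for u using assms(2) by blast
  then show ?thesis
    using assms(1) unfolding seminorm_def norm_on_def
    by (simp add: linear_add[OF assms(3)] linear_scale[OF assms(3)])
qed

lemma linear_data_map:
  assumes "\<forall>l\<in>\<Lambda>. linear l"
  shows "linear (data_map \<Lambda>)"
  using assms
  by (intro linearI) (auto simp: data_map_def fun_eq_iff scaleR_fun_def linear_add linear_scale)

text \<open>
  Pulling the norms back to \<open>U\<close> turns them into seminorms on one and the same vector space, where
  they can be compared although the restrictions map into different spaces.
\<close>

definition restricted_data_norm where
  "restricted_data_norm \<Lambda> r u = restr_norm r (restr_map r (data_map \<Lambda> u))"

definition full_data_norm where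
  "full_data_norm \<Lambda> normV u = normV (data_map \<Lambda> u)"

lemma seminorm_full_data_norm:
  assumes "analytic_problem \<Lambda> V normV"
  shows "seminorm (full_data_norm \<Lambda> normV)"
  using norm_on_linear_seminorm[of V normV "data_map \<Lambda>"] linear_data_map[of \<Lambda>] assms
  unfolding full_data_norm_def[abs_def] analytic_problem_def by blast

lemma seminorm_restricted_data_norm:
  assumes ap: "analytic_problem \<Lambda> V normV" and mrd: "mrd_discretization V normV A leq"
    and r: "r \<in> A"
  shows "seminorm (restricted_data_norm \<Lambda> r)"
proof -
  have lin: "linear (data_map \<Lambda>)" and DV: "data_map \<Lambda> u \<in> V" for u
    using ap linear_data_map[of \<Lambda>] by (auto simp: analytic_problem_def)
  have R: "norm_on (restr_space r) (restr_norm r)" "restr_map r ` V \<subseteq> restr_space r"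
    "linear_from V (restr_map r)"
    using mrd r by (auto simp: mrd_discretization_def)
  have "linear (\<lambda>u. restr_map r (data_map \<Lambda> u))"
    using R(3) DV by (intro linearI)
      (auto simp: linear_from_def linear_add[OF lin] linear_scale[OF lin])
  moreover have "range (\<lambda>u. restr_map r (data_map \<Lambda> u)) \<subseteq> restr_space r"
    using R(2) DV by auto
  ultimately show ?thesis
    unfolding restricted_data_norm_def[abs_def] using R(1) norm_on_linear_seminorm by blast
qed

lemma restricted_le_full_data_norm:
  assumes ap: "analytic_problem \<Lambda> V normV" and mrd: "mrd_discretization V normV A leq"
    and r: "r \<in> A"
  shows "restricted_data_norm \<Lambda> r u \<le> full_data_norm \<Lambda> normV u"
proof -
  have "data_map \<Lambda> u \<in> V"
    using ap by (auto simp: analytic_problem_def)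
  then have "ennreal (full_data_norm \<Lambda> normV u)
      = (SUP r\<in>A. ennreal (restricted_data_norm \<Lambda> r u))"
    using mrd by (simp add: mrd_discretization_def full_data_norm_def restricted_data_norm_def)
  then have "ennreal (restricted_data_norm \<Lambda> r u) \<le> ennreal (full_data_norm \<Lambda> normV u)"
    using r by (metis SUP_upper)
  then show ?thesis
    using seminorm_nonneg[OF seminorm_full_data_norm[OF ap]] by simp
qed

lemma restricted_near_full_data_norm:
  assumes ap: "analytic_problem \<Lambda> V normV" and mrd: "mrd_discretization V normV A leq"
    and e: "0 < e"
  shows "\<exists>r\<in>A. full_data_norm \<Lambda> normV u - e < restricted_data_norm \<Lambda> r u"
proof (rule ccontr)
  assume "\<not> ?thesis"
  then have le: "restricted_data_norm \<Lambda> r u \<le> full_data_norm \<Lambda> normV u - e" if "r \<in> A" for r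
    using that by force
  obtain r where r: "r \<in> A"
    using mrd by (auto simp: mrd_discretization_def)
  have nonneg: "0 \<le> full_data_norm \<Lambda> normV u - e"
    using le[OF r] seminorm_nonneg[OF seminorm_restricted_data_norm[OF ap mrd r], of u] by linarith
  have "data_map \<Lambda> u \<in> V"
    using ap by (auto simp: analytic_problem_def)
  then have "ennreal (full_data_norm \<Lambda> normV u)
      = (SUP r\<in>A. ennreal (restricted_data_norm \<Lambda> r u))"
    using mrd by (simp add: mrd_discretization_def full_data_norm_def restricted_data_norm_def)
  also have "\<dots> \<le> ennreal (full_data_norm \<Lambda> normV u - e)"
    using le by (intro SUP_least ennreal_leI)
  finally show False
    using nonneg e by simp
qed

lemma norming_restriction_exists:
  assumes ap: "analytic_problem \<Lambda> V normV" and mrd: "mrd_discretization V normV A leq"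
    and T: "finite_dim_subspace T"
  shows "\<exists>r\<in>A. \<forall>u\<in>T. full_data_norm \<Lambda> normV u \<le> 2 * restricted_data_norm \<Lambda> r u"
proof (rule directed_seminorms_norming)
  fix r s assume rs: "r \<in> A" "s \<in> A"
  then obtain t where t: "t \<in> A" "leq r t" "leq s t"
    using mrd unfolding mrd_discretization_def by blast
  have "data_map \<Lambda> u \<in> V" for u
    using ap by (auto simp: analytic_problem_def)
  then show "\<exists>t\<in>A. \<forall>u. restricted_data_norm \<Lambda> r u \<le> restricted_data_norm \<Lambda> t u \<and>
      restricted_data_norm \<Lambda> s u \<le> restricted_data_norm \<Lambda> t u"
    using mrd rs t unfolding mrd_discretization_def restricted_data_norm_def
    by (intro bexI[of _ t]) auto
next
  show "A \<noteq> {}" using mrd by (simp add: mrd_discretization_def)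
qed (use assms in \<open>auto intro: seminorm_full_data_norm seminorm_restricted_data_norm
    restricted_le_full_data_norm restricted_near_full_data_norm\<close>)

section \<open>Stability and convergence\<close>

text \<open>
  The sign of \<open>C\<close> is not prescribed. A negative \<open>C\<close> is compatible with well-posedness only if the full
  data norm vanishes identically, and then any nonnegative quantities bounded by it vanish too; so
  multiplication by \<open>C\<close> preserves their order in all cases.
\<close>

lemma well_posed_mult_mono:
  assumes ap: "analytic_problem \<Lambda> V normV" and wp: "well_posed \<Lambda> normV normWP C"
    and "a \<le> b" "0 \<le> a" "b \<le> K * full_data_norm \<Lambda> normV u"
  shows "C * a \<le> C * b"
proof (cases "0 \<le> C")
  case True
  then show ?thesis using assms(3) by (rule mult_left_mono[rotated])
next
  case False
  have "0 \<le> normWP u" "normWP u \<le> C * full_data_norm \<Lambda> normV u"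
    using wp by (auto simp: well_posed_def norm_on_def full_data_norm_def)
  then have "0 \<le> C * full_data_norm \<Lambda> normV u"
    by linarith
  then have "full_data_norm \<Lambda> normV u = 0"
    using False seminorm_nonneg[OF seminorm_full_data_norm[OF ap], of u]
    by (simp add: zero_le_mult_iff)
  then have "a = 0" "b = 0" using assms(3-5) by simp_all
  then show ?thesis by simp
qed

lemma norming_imp_uniformly_stable:
  assumes ap: "analytic_problem \<Lambda> V normV" and mrd: "mrd_discretization V normV A leq"
    and wp: "well_posed \<Lambda> normV normWP C" and r: "r \<in> A"
    and norming: "\<And>u. u \<in> T \<Longrightarrow> full_data_norm \<Lambda> normV u \<le> 2 * restricted_data_norm \<Lambda> r u"
  shows "uniformly_stable \<Lambda> normWP C T r"
  unfolding uniformly_stable_def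
proof
  fix u assume u: "u \<in> T"
  have "normWP u \<le> C * full_data_norm \<Lambda> normV u"
    using wp by (simp add: well_posed_def full_data_norm_def)
  also have "\<dots> \<le> C * (2 * restricted_data_norm \<Lambda> r u)"
    using restricted_le_full_data_norm[OF ap mrd r, of u]
    by (intro well_posed_mult_mono[OF ap wp norming[OF u], where u = u and K = 2]
        seminorm_nonneg[OF seminorm_full_data_norm[OF ap]]) simp
  finally show "normWP u \<le> 2 * C * restr_norm r (restr_map r (data_map \<Lambda> u))"
    by (simp add: restricted_data_norm_def)
qed

lemma uniformly_stable_imp_convergence_bound:
  assumes ap: "analytic_problem \<Lambda> V normV" and mrd: "mrd_discretization V normV A leq"
    and wp: "well_posed \<Lambda> normV normWP C" and r: "r \<in> A" and T: "subspace T"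
    and stable: "uniformly_stable \<Lambda> normWP C T r"
  shows "convergence_bound \<Lambda> normV normWP C T r"
  unfolding convergence_bound_def
proof (intro allI impI ballI)
  fix c :: real and us um ut
  assume c: "1 \<le> c" and um: "um \<in> T" and ut: "ut \<in> T"
    and min: "approx_residual_minimizer \<Lambda> r c us um ut"
  let ?p = "full_data_norm \<Lambda> normV" and ?q = "restricted_data_norm \<Lambda> r"
  have q: "seminorm ?q"
    by (rule seminorm_restricted_data_norm[OF ap mrd r])
  have qp: "?q (us - um) \<le> ?p (us - um)"
    by (rule restricted_le_full_data_norm[OF ap mrd r])
  have "?q (um - ut) \<le> ?q (us - ut) + ?q (us - um)"
    using seminorm_diff[OF q, of "us - ut" "us - um"] by simp
  also have "\<dots> \<le> (1 + c) * ?q (us - um)"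
    using min by (simp add: approx_residual_minimizer_def restricted_data_norm_def algebra_simps)
  also have "\<dots> \<le> (1 + c) * ?p (us - um)"
    using c qp by (intro mult_left_mono) auto
  finally have res: "?q (um - ut) \<le> (1 + c) * ?p (us - um)" .
  have "normWP (us - ut) \<le> normWP (us - um) + normWP (um - ut)"
  proof -
    have "normWP (us - um + (um - ut)) \<le> normWP (us - um) + normWP (um - ut)"
      using wp unfolding well_posed_def norm_on_def by blast
    then show ?thesis by simp
  qed
  also have "normWP (us - um) \<le> C * ?p (us - um)"
    using wp by (simp add: well_posed_def full_data_norm_def)
  also have "normWP (um - ut) \<le> 2 * (C * ?q (um - ut))"
    using stable subspace_diff[OF T um ut]
    by (auto simp: uniformly_stable_def restricted_data_norm_def)
  also have "C * ?q (um - ut) \<le> C * ((1 + c) * ?p (us - um))"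
    by (rule well_posed_mult_mono[OF ap wp res seminorm_nonneg[OF q] order_refl])
  also have "C * ?p (us - um) + 2 * (C * ((1 + c) * ?p (us - um)))
      = C * (2 * c + 3) * ?p (us - um)"
    by (simp add: algebra_simps)
  also have "?p (us - um) = normV (data_map \<Lambda> us - data_map \<Lambda> um)"
    using ap linear_data_map[of \<Lambda>]
    by (simp add: full_data_norm_def analytic_problem_def linear_diff)
  finally show "normWP (us - ut) \<le> C * (2 * c + 3) * normV (data_map \<Lambda> us - data_map \<Lambda> um)"
    by simp
qed

theorem theorem7p4:
  fixes \<Lambda> :: "('u::real_normed_vector \<Rightarrow> real) set"
    and V :: "(('u \<Rightarrow> real) \<Rightarrow> real) set"
    and normV :: "(('u \<Rightarrow> real) \<Rightarrow> real) \<Rightarrow> real"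
    and A :: "(('u \<Rightarrow> real) \<Rightarrow> real, 'w::real_vector) restriction set"
    and leq :: "(('u \<Rightarrow> real) \<Rightarrow> real, 'w) restriction \<Rightarrow>
                    (('u \<Rightarrow> real) \<Rightarrow> real, 'w) restriction \<Rightarrow> bool"
    and normWP :: "'u \<Rightarrow> real"
    and C :: real
  assumes "analytic_problem \<Lambda> V normV"
    and "mrd_discretization V normV A leq"
    and "well_posed \<Lambda> normV normWP C"
  shows "(\<forall>T. finite_dim_subspace T \<longrightarrow>
            (\<exists>r\<in>A. uniformly_stable \<Lambda> normWP C T r \<and>
                    convergence_bound \<Lambda> normV normWP C T r))
       \<and> (\<forall>C\<^sub>A\<ge>1. \<forall>us. \<forall>T :: nat \<Rightarrow> 'u set.
            \<forall>r :: nat \<Rightarrow> (('u \<Rightarrow> real) \<Rightarrow> real, 'w) restriction.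
            \<forall>um ut :: nat \<Rightarrow> 'u. \<forall>\<epsilon> :: nat \<Rightarrow> real.
            (\<forall>M. finite_dim_subspace (T M) \<and> r M \<in> A \<and>
                 uniformly_stable \<Lambda> normWP C (T M) (r M) \<and>
                 convergence_bound \<Lambda> normV normWP C (T M) (r M) \<and>
                 um M \<in> T M \<and> ut M \<in> T M \<and>
                 approx_residual_minimizer \<Lambda> (r M) C\<^sub>A us (um M) (ut M)) \<longrightarrow>
            \<epsilon> \<longlonglongrightarrow> 0 \<longrightarrow>
            (\<lambda>M. normV (data_map \<Lambda> us - data_map \<Lambda> (um M))) \<in> O(\<epsilon>) \<longrightarrow>
            (\<lambda>M. normWP (us - ut M)) \<in> O(\<epsilon>))"
proof (intro conjI allI impI)
  fix T :: "'u set"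
  assume T: "finite_dim_subspace T"
  then obtain r where r: "r \<in> A"
    "\<And>u. u \<in> T \<Longrightarrow> full_data_norm \<Lambda> normV u \<le> 2 * restricted_data_norm \<Lambda> r u"
    using norming_restriction_exists[OF assms(1,2)] by blast
  have "subspace T"
    using T by (auto simp: finite_dim_subspace_def)
  then have "uniformly_stable \<Lambda> normWP C T r \<and> convergence_bound \<Lambda> normV normWP C T r"
    using norming_imp_uniformly_stable[OF assms r]
      uniformly_stable_imp_convergence_bound[OF assms r(1)] by blast
  with r(1) show "\<exists>r\<in>A. uniformly_stable \<Lambda> normWP C T r \<and> convergence_bound \<Lambda> normV normWP C T r"
    by blast
next
  fix C\<^sub>A :: real and us :: 'u and T :: "nat \<Rightarrow> 'u set"
    and r :: "nat \<Rightarrow> (('u \<Rightarrow> real) \<Rightarrow> real, 'w) restriction"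
    and um ut :: "nat \<Rightarrow> 'u" and \<epsilon> :: "nat \<Rightarrow> real"
  assume C\<^sub>A: "1 \<le> C\<^sub>A"
    and seq: "\<forall>M. finite_dim_subspace (T M) \<and> r M \<in> A \<and>
                 uniformly_stable \<Lambda> normWP C (T M) (r M) \<and>
                 convergence_bound \<Lambda> normV normWP C (T M) (r M) \<and>
                 um M \<in> T M \<and> ut M \<in> T M \<and>
                 approx_residual_minimizer \<Lambda> (r M) C\<^sub>A us (um M) (ut M)"
    and rate: "(\<lambda>M. normV (data_map \<Lambda> us - data_map \<Lambda> (um M))) \<in> O(\<epsilon>)"
  let ?K = "C * (2 * C\<^sub>A + 3)"
  have "\<bar>normWP (us - ut M)\<bar> \<le> \<bar>?K\<bar> * \<bar>normV (data_map \<Lambda> us - data_map \<Lambda> (um M))\<bar>" for M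
  proof -
    have "normWP (us - ut M) \<le> ?K * normV (data_map \<Lambda> us - data_map \<Lambda> (um M))"
      using seq C\<^sub>A unfolding convergence_bound_def by blast
    moreover have "0 \<le> normWP (us - ut M)"
      using assms(3) by (simp add: well_posed_def norm_on_def)
    ultimately show ?thesis
      by (simp only: abs_mult[symmetric])
  qed
  then have "(\<lambda>M. normWP (us - ut M)) \<in> O(\<lambda>M. normV (data_map \<Lambda> us - data_map \<Lambda> (um M)))"
    by (intro bigoI[where c = "\<bar>?K\<bar>"]) simp
  then show "(\<lambda>M. normWP (us - ut M)) \<in> O(\<epsilon>)"
    using rate by (rule landau_o.big_trans)
qed

end
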